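(* Let $\mu$ and $\nu$ be two finite measures on $\mathbb{R}^N$ and let $\lambda>0$. Let $L_0$ be the space of constant functions and let $L_1$ be the space of all functions $u$ such that $$\int_{\mathbb{R}^N}|\nabla u|^2\,d\mu=\lambda\int_{\mathbb{R}^N}|u|^2\,d\nu.$$ Suppose that $W$ is another space such that $L_0$, $L_1$ and $W$ are orthogonal to each other with respect to $W^{1,2}(d\mu)$ and $L^2(d\nu)$. Then, for $\alpha>0$, the following are equivalent: (1) For all $u=u_0+u_1+w$ with $u_0\in L_0$, $u_1\in L_1$, $w\in W$, $$\int_{\mathbb{R}^N}|\nabla u|^2\,d\mu-\lambda\inf_{c\in\mathbb{R}}\int_{\mathbb{R}^N}|u-c|^2\,d\nu\ge\alpha\inf_{c\in\mathbb{R},\phi\in L_1}\int_{\mathbb{R}^N}|u-c-\phi|^2\,d\nu.$$ (2) For all $u=u_0+u_1+w$ with $u_0\in L_0$, $u_1\in L_1$, $w\in W$, $$\int_{\mathbb{R}^N}|\nabla u|^2\,d\mu-\lambda\inf_{c\in\mathbb{R}}\int_{\mathbb{R}^N}|u-c|^2\,d\nu\ge\frac{\alpha}{\lambda+\alpha}\inf_{\phi\in L_1}\int_{\mathbb{R}^N}|\nabla(u-\phi)|^2\,d\mu.$$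
   Context: All functions are real-valued functions on $\mathbb{R}^N$ with a gradient, with $\int|\nabla u|^2d\mu<\infty$ and $\int|u|^2d\nu<\infty$; $L_0,L_1,W$ are regarded as linear spaces of such functions. Orthogonality of $f$ and $g$ with respect to $W^{1,2}(d\mu)$ means $\int_{\mathbb{R}^N}\nabla f\cdot\nabla g\,d\mu=0$, and with respect to $L^2(d\nu)$ means $\int_{\mathbb{R}^N}fg\,d\nu=0$. *)

theory Defs
  imports "HOL-Analysis.Analysis"
begin

definition grad :: "('a::real_inner \<Rightarrow> real) \<Rightarrow> 'a \<Rightarrow> 'a" where
  "grad u x = (THE D. GDERIV u x :> D)"

definition energy :: "(real^'n) measure \<Rightarrow> (real^'n \<Rightarrow> real) \<Rightarrow> real" where
  "energy \<mu> u = (\<integral>x. (norm (grad u x))\<^sup>2 \<partial>\<mu>)"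

definition mass :: "(real^'n) measure \<Rightarrow> (real^'n \<Rightarrow> real) \<Rightarrow> real" where
  "mass \<nu> u = (\<integral>x. \<bar>u x\<bar>\<^sup>2 \<partial>\<nu>)"

text \<open>The functions under consideration: those with a gradient at every point
  and with finite integrals of \<open>|\<nabla>u|\<^sup>2\<close> and \<open>|u|\<^sup>2\<close>.\<close>

definition admissible ::
  "(real^'n) measure \<Rightarrow> (real^'n) measure \<Rightarrow> (real^'n \<Rightarrow> real) set" where
  "admissible \<mu> \<nu> = {u. (\<forall>x. \<exists>D. GDERIV u x :> D)
     \<and> integrable \<mu> (\<lambda>x. (norm (grad u x))\<^sup>2)
     \<and> integrable \<nu> (\<lambda>x. \<bar>u x\<bar>\<^sup>2)}"

text \<open>Stated explicitly because \<open>real^'n \<Rightarrow> real\<close> is not an instance of class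
  \<open>real_vector\<close>. No functions are identified up to null sets.\<close>

definition linear_space :: "('a \<Rightarrow> real) set \<Rightarrow> bool" where
  "linear_space V \<longleftrightarrow> (\<lambda>x. 0) \<in> V
     \<and> (\<forall>u\<in>V. \<forall>v\<in>V. (\<lambda>x. u x + v x) \<in> V)
     \<and> (\<forall>a. \<forall>u\<in>V. (\<lambda>x. a * u x) \<in> V)"

definition orthogonal_spaces ::
  "(real^'n) measure \<Rightarrow> (real^'n) measure \<Rightarrow>
   (real^'n \<Rightarrow> real) set \<Rightarrow> (real^'n \<Rightarrow> real) set \<Rightarrow> bool" where
  "orthogonal_spaces \<mu> \<nu> A B \<longleftrightarrow> (\<forall>f\<in>A. \<forall>g\<in>B.
     (\<integral>x. grad f x \<bullet> grad g x \<partial>\<mu>) = 0 \<and> (\<integral>x. f x * g x \<partial>\<nu>) = 0)"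

definition L0_space :: "('a \<Rightarrow> real) set" where
  "L0_space = range (\<lambda>c x. c)"

text \<open>The parameter \<open>F\<close> is the class of functions among which \<open>L\<^sub>1\<close> is formed.
  It may be all of \<open>admissible \<mu> \<nu>\<close>, but it has to be allowed to be smaller:
  if \<open>\<mu>\<close> and \<open>\<nu>\<close> are both nonzero, there is an admissible \<open>u\<close> (oscillating fast)
  with \<open>energy \<mu> u > \<lambda> * mass \<nu> u\<close>, and \<open>u + c\<close> satisfies the equation for two
  different constants \<open>c\<close>, while a nonzero constant never does. So the solutions among
  all admissible functions are then not a linear space. A typical \<open>F\<close> is the class
  of admissible functions with \<open>\<nu>\<close>-mean zero.\<close>

definition L1_space ::
  "(real^'n) measure \<Rightarrow> (real^'n) measure \<Rightarrow> real \<Rightarrow>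
   (real^'n \<Rightarrow> real) set \<Rightarrow> (real^'n \<Rightarrow> real) set" where
  "L1_space \<mu> \<nu> l F = {u \<in> F. energy \<mu> u = l * mass \<nu> u}"

end

theory Submission
  imports Defs
begin

text \<open>For \<open>u = u\<^sub>0 + u\<^sub>1 + w\<close>, orthogonality gives Pythagorean identities for the energy and the mass,
  so each infimum is attained at \<open>c = u\<^sub>0\<close>, \<open>\<phi> = u\<^sub>1\<close>. As the energy of \<open>u\<^sub>1\<close> is \<open>\<lambda>\<close> times its mass,
  the left-hand sides reduce to \<open>E(w) - \<lambda> M(w)\<close>, the right-hand sides to \<open>\<alpha> M(w)\<close> and
  \<open>\<alpha> E(w) / (\<lambda> + \<alpha>)\<close>, and both inequalities say \<open>E(w) \<ge> (\<lambda> + \<alpha>) M(w)\<close>.\<close>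

section \<open>Pointwise gradients and their measurability\<close>

lemma grad_eq:
  assumes "GDERIV u x :> D"
  shows "grad u x = D"
  unfolding grad_def
proof (rule the_equality)
  fix D' assume "GDERIV u x :> D'"
  with assms have "(\<lambda>h. D' \<bullet> h) = (\<lambda>h. D \<bullet> h)"
    by (auto simp: gderiv_def inner_commute intro: has_derivative_unique)
  then show "D' = D"
    by (metis vector_eq_rdot)
qed (fact assms)

lemma GDERIV_grad:
  assumes "\<exists>D. GDERIV u x :> D"
  shows "GDERIV u x :> grad u x"
  using assms grad_eq by metis

lemma borel_measurable_of_GDERIV:
  fixes u :: "'a::euclidean_space \<Rightarrow> real"
  assumes "\<And>x. \<exists>D. GDERIV u x :> D"
  shows "u \<in> borel_measurable borel"
proof (rule borel_measurable_continuous_onI)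
  show "continuous_on UNIV u"
    using assms by (auto simp: continuous_on_eq_continuous_at gderiv_def
        intro: has_derivative_continuous)
qed

text \<open>Each partial derivative is a pointwise limit of difference quotients of the continuous
  function \<open>u\<close>. Admissibility asks only that the squared norm of the gradient be
  integrable, whereas the cross terms below need the gradient itself to be measurable.\<close>

lemma borel_measurable_grad:
  fixes u :: "'a::euclidean_space \<Rightarrow> real"
  assumes d: "\<And>x. \<exists>D. GDERIV u x :> D"
  shows "grad u \<in> borel_measurable borel"
proof (subst borel_measurable_euclidean_space, intro ballI)
  fix i :: 'a assume i: "i \<in> Basis"
  note m [measurable] = borel_measurable_of_GDERIV[OF d]
  define q where "q n x = (u (x + inverse (real (Suc n)) *\<^sub>R i) - u x) / inverse (real (Suc n))" for n x
  show "(\<lambda>x. grad u x \<bullet> i) \<in> borel_measurable borel"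
  proof (rule borel_measurable_LIMSEQ_real)
    show "q n \<in> borel_measurable borel" for n
      unfolding q_def by measurable
    fix x
    \<comment> \<open>The base point is written \<open>x + 0 *\<^sub>R i\<close> to fit the chain
      rule along the line \<open>x + t *\<^sub>R i\<close> at \<open>t = 0\<close>.\<close>
    have "(u has_derivative (\<lambda>h. h \<bullet> grad u x)) (at (x + 0 *\<^sub>R i))"
      using GDERIV_grad[OF d] by (simp add: gderiv_def)
    moreover have "((\<lambda>t. x + t *\<^sub>R i) has_derivative (\<lambda>t. t *\<^sub>R i)) (at (0::real))"
      by (auto intro!: derivative_eq_intros)
    ultimately have "((\<lambda>t. u (x + t *\<^sub>R i)) has_derivative (\<lambda>t. (t *\<^sub>R i) \<bullet> grad u x)) (at 0)"
      by (rule has_derivative_compose[rotated])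
    then have "((\<lambda>t. u (x + t *\<^sub>R i)) has_real_derivative grad u x \<bullet> i) (at 0)"
      unfolding has_field_derivative_def
      by (rule has_derivative_eq_rhs) (auto simp: inner_commute mult.commute)
    then have "((\<lambda>t. (u (x + t *\<^sub>R i) - u x) / t) \<longlongrightarrow> grad u x \<bullet> i) (at 0)"
      by (simp add: DERIV_def)
    \<comment> \<open>The steps 1/(n+1) tend to 0 and are never 0, as the punctured filter
      \<open>at 0\<close> demands.\<close>
    moreover have "filterlim (\<lambda>n. inverse (real (Suc n))) (at 0) sequentially"
      using LIMSEQ_inverse_real_of_nat by (auto simp: filterlim_at)
    ultimately show "(\<lambda>n. q n x) \<longlonglongrightarrow> grad u x \<bullet> i"
      unfolding q_def by (rule filterlim_compose)
  qed
qed

section \<open>Integrals of inner products and of squared norms\<close>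

lemma integrable_inner_square:
  fixes f g :: "'b \<Rightarrow> 'a::euclidean_space"
  assumes [measurable]: "f \<in> borel_measurable M" "g \<in> borel_measurable M"
    and f: "integrable M (\<lambda>x. (norm (f x))\<^sup>2)" and g: "integrable M (\<lambda>x. (norm (g x))\<^sup>2)"
  shows "integrable M (\<lambda>x. f x \<bullet> g x)"
proof (rule Bochner_Integration.integrable_bound)
  show "integrable M (\<lambda>x. (norm (f x))\<^sup>2 + (norm (g x))\<^sup>2)"
    using f g by simp
  show "(\<lambda>x. f x \<bullet> g x) \<in> borel_measurable M"
    by measurable
  \<comment> \<open>Cauchy-Schwarz followed by 2rs \<le> r^2 + s^2 gives an integrable
    majorant.\<close>
  have "\<bar>a \<bullet> b\<bar> \<le> (norm a)\<^sup>2 + (norm b)\<^sup>2" for a b :: 'a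
  proof -
    have "2 * (norm a * norm b) \<le> (norm a)\<^sup>2 + (norm b)\<^sup>2"
      using sum_squares_bound[of "norm a" "norm b"] by (simp add: mult.assoc)
    moreover have "0 \<le> norm a * norm b"
      by simp
    ultimately show ?thesis
      using Cauchy_Schwarz_ineq2[of a b] by linarith
  qed
  then show "AE x in M. norm (f x \<bullet> g x) \<le> norm ((norm (f x))\<^sup>2 + (norm (g x))\<^sup>2)"
    by simp
qed

lemma norm_add_square:
  fixes a b :: "'a::real_inner"
  shows "(norm (a + b))\<^sup>2 = (norm a)\<^sup>2 + 2 * (a \<bullet> b) + (norm b)\<^sup>2"
  by (simp add: power2_norm_eq_inner inner_add inner_commute)

text \<open>Vector values let one statement serve twice: with gradients it expands the energy of a
  sum, and with real functions, where the inner product is multiplication, the mass.\<close>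

lemma
  fixes f g :: "'b \<Rightarrow> 'a::euclidean_space"
  assumes fm: "f \<in> borel_measurable M" and gm: "g \<in> borel_measurable M"
    and f: "integrable M (\<lambda>x. (norm (f x))\<^sup>2)" and g: "integrable M (\<lambda>x. (norm (g x))\<^sup>2)"
  shows integrable_norm_add_square: "integrable M (\<lambda>x. (norm (f x + g x))\<^sup>2)"
    and integral_norm_add_square: "(\<integral>x. (norm (f x + g x))\<^sup>2 \<partial>M)
      = (\<integral>x. (norm (f x))\<^sup>2 \<partial>M) + 2 * (\<integral>x. f x \<bullet> g x \<partial>M) + (\<integral>x. (norm (g x))\<^sup>2 \<partial>M)"
  using f g integrable_inner_square[OF assms] by (simp_all add: norm_add_square)

lemma GDERIV_add_grad:
  assumes "\<exists>D. GDERIV f x :> D" "\<exists>D. GDERIV g x :> D"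
  shows "GDERIV (\<lambda>x. f x + g x) x :> grad f x + grad g x"
  using assms by (intro GDERIV_add GDERIV_grad)

lemma grad_const [simp]: "grad (\<lambda>x. c) x = 0"
  by (intro grad_eq GDERIV_const)

section \<open>Pythagorean identities for energy and mass\<close>

context
  fixes \<mu> \<nu> :: "(real^'n) measure"
  assumes sets [measurable_cong]: "sets \<mu> = sets borel" "sets \<nu> = sets borel"
begin

lemma admissible_measurable:
  assumes "u \<in> admissible \<mu> \<nu>"
  shows "u \<in> borel_measurable \<nu>" "grad u \<in> borel_measurable \<mu>"
proof -
  have "\<And>x. \<exists>D. GDERIV u x :> D"
    using assms by (simp add: admissible_def)
  note borel_measurable_of_GDERIV[OF this, measurable] borel_measurable_grad[OF this, measurable]
  show "u \<in> borel_measurable \<nu>" "grad u \<in> borel_measurable \<mu>"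
    by measurable
qed

lemma
  assumes f: "f \<in> admissible \<mu> \<nu>" and g: "g \<in> admissible \<mu> \<nu>"
  shows admissible_add: "(\<lambda>x. f x + g x) \<in> admissible \<mu> \<nu>"
    and energy_add: "energy \<mu> (\<lambda>x. f x + g x)
      = energy \<mu> f + 2 * (\<integral>x. grad f x \<bullet> grad g x \<partial>\<mu>) + energy \<mu> g"
    and mass_add: "mass \<nu> (\<lambda>x. f x + g x)
      = mass \<nu> f + 2 * (\<integral>x. f x * g x \<partial>\<nu>) + mass \<nu> g"
    and integrable_mult_admissible: "integrable \<nu> (\<lambda>x. f x * g x)"
proof -
  have G: "GDERIV (\<lambda>x. f x + g x) x :> grad f x + grad g x" for x
    using f g by (intro GDERIV_add_grad) (auto simp: admissible_def)
  have [simp]: "grad (\<lambda>x. f x + g x) x = grad f x + grad g x" for x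
    by (rule grad_eq[OF G])
  have fg: "integrable \<mu> (\<lambda>x. (norm (grad f x))\<^sup>2)" "integrable \<nu> (\<lambda>x. (norm (f x))\<^sup>2)"
    "integrable \<mu> (\<lambda>x. (norm (grad g x))\<^sup>2)" "integrable \<nu> (\<lambda>x. (norm (g x))\<^sup>2)"
    using f g by (simp_all add: admissible_def)
  note E = admissible_measurable(2)[OF f] admissible_measurable(2)[OF g] fg(1,3)
  note M = admissible_measurable(1)[OF f] admissible_measurable(1)[OF g] fg(2,4)
  show "(\<lambda>x. f x + g x) \<in> admissible \<mu> \<nu>"
    using G integrable_norm_add_square[OF E] integrable_norm_add_square[OF M]
    by (auto simp: admissible_def)
  show "energy \<mu> (\<lambda>x. f x + g x)
      = energy \<mu> f + 2 * (\<integral>x. grad f x \<bullet> grad g x \<partial>\<mu>) + energy \<mu> g"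
    using integral_norm_add_square[OF E] by (simp add: energy_def)
  show "mass \<nu> (\<lambda>x. f x + g x) = mass \<nu> f + 2 * (\<integral>x. f x * g x \<partial>\<nu>) + mass \<nu> g"
    using integral_norm_add_square[OF M] by (simp add: mass_def)
  show "integrable \<nu> (\<lambda>x. f x * g x)"
    using integrable_inner_square[OF M] by simp
qed

text \<open>The gradient vanishes, and finiteness of \<open>\<nu>\<close> makes the constant square
  integrable.\<close>

lemma admissible_const:
  assumes "finite_measure \<nu>"
  shows "(\<lambda>x. c) \<in> admissible \<mu> \<nu>"
proof -
  interpret finite_measure \<nu> by fact
  show ?thesis
    by (auto simp: admissible_def intro!: exI GDERIV_const)
qed

text \<open>All cross terms vanish. The constant keeps its mass but contributes no energy, its
  gradient being zero. In the theorem \<open>A\<close> is \<open>L1\<close> and \<open>B\<close> is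
  \<open>W\<close>.\<close>

lemma orthogonal_decomposition:
  assumes "finite_measure \<nu>"
    and A: "A \<subseteq> admissible \<mu> \<nu>" and B: "B \<subseteq> admissible \<mu> \<nu>"
    and "orthogonal_spaces \<mu> \<nu> L0_space A" "orthogonal_spaces \<mu> \<nu> L0_space B"
      "orthogonal_spaces \<mu> \<nu> A B"
    and f: "f \<in> A" and g: "g \<in> B"
  shows "energy \<mu> (\<lambda>x. c + f x + g x) = energy \<mu> f + energy \<mu> g"
    and "mass \<nu> (\<lambda>x. c + f x + g x) = mass \<nu> (\<lambda>x. c) + mass \<nu> f + mass \<nu> g"
proof -
  note c = admissible_const[OF assms(1), of c]
  have f': "f \<in> admissible \<mu> \<nu>" and g': "g \<in> admissible \<mu> \<nu>"
    using A B f g by auto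
  have cL: "(\<lambda>x. c) \<in> L0_space"
    by (simp add: L0_space_def)
  have z: "(\<integral>x. c * f x \<partial>\<nu>) = 0" "(\<integral>x. c * g x \<partial>\<nu>) = 0" "(\<integral>x. f x * g x \<partial>\<nu>) = 0"
    "(\<integral>x. grad f x \<bullet> grad g x \<partial>\<mu>) = 0"
    using bspec[OF bspec[OF assms(4)[unfolded orthogonal_spaces_def] cL] f]
      bspec[OF bspec[OF assms(5)[unfolded orthogonal_spaces_def] cL] g]
      bspec[OF bspec[OF assms(6)[unfolded orthogonal_spaces_def] f] g]
    by simp_all
  note fg = admissible_add[OF f' g']
  \<comment> \<open>Orthogonality is given for \<open>f\<close> and \<open>g\<close> separately, so
    it passes to their sum by linearity of the integral, which needs both products to be
    integrable.\<close>
  have "(\<integral>x. c * (f x + g x) \<partial>\<nu>) = (\<integral>x. c * f x \<partial>\<nu>) + (\<integral>x. c * g x \<partial>\<nu>)"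
    unfolding distrib_left
    by (intro Bochner_Integration.integral_add integrable_mult_admissible c f' g')
  then show "mass \<nu> (\<lambda>x. c + f x + g x) = mass \<nu> (\<lambda>x. c) + mass \<nu> f + mass \<nu> g"
    using mass_add[OF c fg] mass_add[OF f' g'] z by (simp only: add.assoc) simp
  show "energy \<mu> (\<lambda>x. c + f x + g x) = energy \<mu> f + energy \<mu> g"
    using energy_add[OF c fg] energy_add[OF f' g'] z
    by (simp add: add.assoc energy_def[of _ "\<lambda>x. c"])
qed

end

section \<open>Attained infima and the equivalence\<close>

lemma energy_nonneg: "0 \<le> energy \<mu> u"
  by (simp add: energy_def)

lemma mass_nonneg: "0 \<le> mass \<nu> u"
  by (simp add: mass_def)

lemma mass_zero: "mass \<nu> (\<lambda>x. 0) = 0"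
  by (simp add: mass_def)

lemma energy_zero: "energy \<mu> (\<lambda>x. 0) = 0"
  by (simp add: energy_def)

text \<open>A real \<open>INF\<close> has a controlled value only when the set is nonempty and
  bounded below; exhibiting a minimiser settles both.\<close>

lemma INF_eq_attained:
  fixes f :: "'a \<Rightarrow> real"
  assumes "a \<in> A" "\<And>x. x \<in> A \<Longrightarrow> f a \<le> f x"
  shows "(INF x\<in>A. f x) = f a"
  using assms by (intro cInf_eq_minimum) auto

theorem theorem2p3:
  fixes \<mu> \<nu> :: "(real^'n) measure"
    and l \<alpha> :: real
    and F L0 L1 W :: "(real^'n \<Rightarrow> real) set"
  assumes "finite_measure \<mu>" and "sets \<mu> = sets borel"
    and "finite_measure \<nu>" and "sets \<nu> = sets borel"
    and "l > 0"
    and "F \<subseteq> admissible \<mu> \<nu>"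
    and "L0 = L0_space"
    and "L1 = L1_space \<mu> \<nu> l F" and "linear_space L1"
    and "W \<subseteq> admissible \<mu> \<nu>" and "linear_space W"
    and "orthogonal_spaces \<mu> \<nu> L0 L1"
    and "orthogonal_spaces \<mu> \<nu> L0 W"
    and "orthogonal_spaces \<mu> \<nu> L1 W"
    and "\<alpha> > 0"
  shows "(\<forall>u0\<in>L0. \<forall>u1\<in>L1. \<forall>w\<in>W. \<forall>u. u = (\<lambda>x. u0 x + u1 x + w x) \<longrightarrow>
            energy \<mu> u - l * (INF c. mass \<nu> (\<lambda>x. u x - c))
              \<ge> \<alpha> * (INF (c, \<phi>) \<in> UNIV \<times> L1. mass \<nu> (\<lambda>x. u x - c - \<phi> x)))
     \<longleftrightarrow> (\<forall>u0\<in>L0. \<forall>u1\<in>L1. \<forall>w\<in>W. \<forall>u. u = (\<lambda>x. u0 x + u1 x + w x) \<longrightarrow>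
            energy \<mu> u - l * (INF c. mass \<nu> (\<lambda>x. u x - c))
              \<ge> \<alpha> / (l + \<alpha>) * (INF \<phi>\<in>L1. energy \<mu> (\<lambda>x. u x - \<phi> x)))"
proof -
  have L1: "L1 \<subseteq> admissible \<mu> \<nu>"
    using assms(6,8) by (auto simp: L1_space_def)
  note decomp = orthogonal_decomposition[OF assms(2,4,3) L1 assms(10)
      assms(12)[unfolded assms(7)] assms(13)[unfolded assms(7)] assms(14)]
  have zero: "(\<lambda>x. 0) \<in> L1"
    using assms(9) by (simp add: linear_space_def)
  \<comment> \<open>Closure under differences keeps \<open>u1 - \<phi>\<close> in \<open>L1\<close>,
    so that every competitor \<open>u - c - \<phi>\<close> is again a constant plus an element of
    \<open>L1\<close> plus \<open>w\<close>.\<close>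
  have diff: "(\<lambda>x. f x - g x) \<in> L1" if "f \<in> L1" "g \<in> L1" for f g
  proof -
    have add: "\<forall>u\<in>L1. \<forall>v\<in>L1. (\<lambda>x. u x + v x) \<in> L1"
      and scale: "\<forall>u\<in>L1. (\<lambda>x. - 1 * u x) \<in> L1"
      using assms(9) unfolding linear_space_def by blast+
    have "(\<lambda>x. f x + - 1 * g x) \<in> L1"
      using bspec[OF bspec[OF add that(1)] bspec[OF scale that(2)]] .
    then show ?thesis by simp
  qed
  \<comment> \<open>The equivalence holds for each single \<open>u\<close>, so the two quantified
    statements agree term by term.\<close>
  have eq: "(\<alpha> * (INF (c, \<phi>) \<in> UNIV \<times> L1. mass \<nu> (\<lambda>x. u x - c - \<phi> x))
        \<le> energy \<mu> u - l * (INF c. mass \<nu> (\<lambda>x. u x - c)))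
      \<longleftrightarrow> (\<alpha> / (l + \<alpha>) * (INF \<phi>\<in>L1. energy \<mu> (\<lambda>x. u x - \<phi> x))
        \<le> energy \<mu> u - l * (INF c. mass \<nu> (\<lambda>x. u x - c)))"
    if u0: "u0 \<in> L0" and u1: "u1 \<in> L1" and w: "w \<in> W" and u: "u = (\<lambda>x. u0 x + u1 x + w x)"
    for u0 u1 w u
  proof -
    obtain k where "u0 = (\<lambda>x. k)"
      using u0 assms(7) by (auto simp: L0_space_def)
    then have u_def: "u = (\<lambda>x. k + u1 x + w x)"
      using u by simp
    have shift: "(\<lambda>x. u x - c - \<phi> x) = (\<lambda>x. (k - c) + (u1 x - \<phi> x) + w x)" for c \<phi>
      by (auto simp: u_def)
    have mass_shift: "mass \<nu> (\<lambda>x. u x - c - \<phi> x)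
        = mass \<nu> (\<lambda>x::real^'n. k - c) + mass \<nu> (\<lambda>x. u1 x - \<phi> x) + mass \<nu> w"
      if "\<phi> \<in> L1" for c \<phi>
      unfolding shift by (rule decomp(2)[OF diff[OF u1 that] w])
    have energy_shift: "energy \<mu> (\<lambda>x. u x - \<phi> x) = energy \<mu> (\<lambda>x. u1 x - \<phi> x) + energy \<mu> w"
      if "\<phi> \<in> L1" for \<phi>
      using decomp(1)[OF diff[OF u1 that] w, of k] shift[of 0 \<phi>] by simp
    \<comment> \<open>This is the competitor with \<open>\<phi> = 0\<close>.\<close>
    have mass_const: "mass \<nu> (\<lambda>x. u x - c) = mass \<nu> (\<lambda>x::real^'n. k - c) + mass \<nu> u1 + mass \<nu> w" for c
      using mass_shift[OF zero, of c] by simp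
    have energy_u: "energy \<mu> u = energy \<mu> u1 + energy \<mu> w"
      using energy_shift[OF zero] by simp
    \<comment> \<open>Only the first summand depends on \<open>c\<close>, and it vanishes at
      \<open>c = k\<close>.\<close>
    have "(INF c. mass \<nu> (\<lambda>x. u x - c)) = mass \<nu> (\<lambda>x. u x - k)"
      by (rule INF_eq_attained) (simp_all add: mass_const mass_nonneg mass_zero)
    then have I1: "(INF c. mass \<nu> (\<lambda>x. u x - c)) = mass \<nu> u1 + mass \<nu> w"
      by (simp add: mass_const mass_zero)
    have "(INF (c, \<phi>) \<in> UNIV \<times> L1. mass \<nu> (\<lambda>x. u x - c - \<phi> x))
        = (case (k, u1) of (c, \<phi>) \<Rightarrow> mass \<nu> (\<lambda>x. u x - c - \<phi> x))"
      by (rule INF_eq_attained) (auto simp: u1 mass_shift mass_nonneg mass_zero)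
    then have I2: "(INF (c, \<phi>) \<in> UNIV \<times> L1. mass \<nu> (\<lambda>x. u x - c - \<phi> x)) = mass \<nu> w"
      by (simp add: u1 mass_shift mass_zero)
    have "(INF \<phi>\<in>L1. energy \<mu> (\<lambda>x. u x - \<phi> x)) = energy \<mu> (\<lambda>x. u x - u1 x)"
      by (rule INF_eq_attained) (simp_all add: u1 energy_shift energy_nonneg energy_zero)
    then have I3: "(INF \<phi>\<in>L1. energy \<mu> (\<lambda>x. u x - \<phi> x)) = energy \<mu> w"
      by (simp add: u1 energy_shift energy_zero)
    \<comment> \<open>The defining equation of \<open>L1\<close> cancels the whole contribution of
      \<open>u1\<close> on the left-hand side.\<close>
    have "energy \<mu> u1 = l * mass \<nu> u1"
      using u1 assms(8) by (simp add: L1_space_def)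
    then have lhs: "energy \<mu> u - l * (INF c. mass \<nu> (\<lambda>x. u x - c)) = energy \<mu> w - l * mass \<nu> w"
      by (simp add: I1 energy_u algebra_simps)
    have pos: "l > 0" "l + \<alpha> > 0"
      using assms(5,15) by auto
    \<comment> \<open>Multiply by \<open>l + \<alpha>\<close>: the terms
      \<open>\<alpha> * energy \<mu> w\<close> cancel and a common factor \<open>l > 0\<close>
      remains, which the next step removes.\<close>
    have "\<alpha> / (l + \<alpha>) * energy \<mu> w \<le> energy \<mu> w - l * mass \<nu> w
        \<longleftrightarrow> l * ((l + \<alpha>) * mass \<nu> w) \<le> l * energy \<mu> w"
      using pos by (simp add: field_simps)
    also have "\<dots> \<longleftrightarrow> \<alpha> * mass \<nu> w \<le> energy \<mu> w - l * mass \<nu> w"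
      unfolding mult_le_cancel_left_pos[OF pos(1)] by (simp add: algebra_simps)
    finally show ?thesis
      unfolding lhs I2 I3 by (rule sym)
  qed
  show ?thesis
    by (intro ball_cong all_cong1 imp_cong refl eq)
qed

end
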